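(* Suppose that $f\in\mathcal{F}_c$ for some $c>0$. Then for every $z_0\in\mathbb{D}$, $$\frac{1-\sqrt{1-4c^2(1-|z_0|^2)^2}}{2c(1-|z_0|^2)^2}\le f^{\sharp}(z_0)\le \frac{1+\sqrt{1-4c^2(1-|z_0|^2)^2}}{2c(1-|z_0|^2)^2}.$$ Both estimates are sharp if and only if $z_0=0$; that is, for any $c>0$ with $\mathcal{F}_c\neq\emptyset$ and for each of the two inequalities, there is a function in $\mathcal{F}_c$ for which equality holds at the point $z_0$ if and only if $z_0=0$.
   Context: $\mathbb{D}=\{z\in\mathbb{C}:|z|<1\}$, and $\mathcal{M}(\mathbb{D})$ is the set of all meromorphic functions in $\mathbb{D}$. For $f\in\mathcal{M}(\mathbb{D})$ the spherical derivative is $f^{\sharp}(z)=\frac{|f'(z)|}{1+|f(z)|^2}$, extended continuously to the poles of $f$ (equivalently $f^\sharp=(1/f)^\sharp$ near a pole). For $c>0$, $\mathcal{F}_c=\{f\in\mathcal{M}(\mathbb{D}): f^{\sharp}(z)\ge c\text{ for all }z\in\mathbb{D}\}$. *)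

theory Defs
  imports "HOL-Complex_Analysis.Complex_Analysis"
begin

definition spherical_deriv :: "(complex \<Rightarrow> complex) \<Rightarrow> complex \<Rightarrow> real" where
  "spherical_deriv f z =
     (if is_pole f z then Lim (at z) (\<lambda>w. norm (deriv f w) / (1 + (norm (f w))\<^sup>2))
      else norm (deriv f z) / (1 + (norm (f z))\<^sup>2))"

text \<open>
  The limit at a pole exists, and the extended function agrees with the spherical derivative of
  the reciprocal of \<open>f\<close>.
\<close>

lemma spherical_deriv_pole:
  assumes f: "f nicely_meromorphic_on A" and z: "z \<in> A" and pole: "is_pole f z"
  shows "((\<lambda>w. norm (deriv f w) / (1 + (norm (f w))\<^sup>2)) \<longlongrightarrow> spherical_deriv f z) (at z)"
    and "spherical_deriv f z = spherical_deriv (\<lambda>w. inverse (f w)) z"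
proof -
  define g where "g = (\<lambda>w. inverse (f w))"
  have mero: "f meromorphic_on {z}"
    using f z meromorphic_on_subset[of f A "{z}"] by (auto simp: nicely_meromorphic_on_def)
  have g_lim: "g \<midarrow>z\<rightarrow> 0"
    using pole unfolding is_pole_def g_def by (rule tendsto_inverse_0[THEN filterlim_compose])
  have fz: "f z = 0"
    using f z pole not_tendsto_and_filterlim_at_infinity[of "at z" f]
    by (auto simp: nicely_meromorphic_on_def is_pole_def)
  have g_ana: "g analytic_on {z}"
  proof (rule meromorphic_at_isCont_imp_analytic)
    show "g meromorphic_on {z}"
      unfolding g_def by (intro meromorphic_intros mero)
    show "isCont g z"
      using g_lim fz by (simp add: isCont_def g_def)
  qed
  have lim: "((\<lambda>w. norm (deriv g w) / (1 + (norm (g w))\<^sup>2)) \<longlongrightarrow>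
               norm (deriv g z) / (1 + (norm (g z))\<^sup>2)) (at z)"
  proof -
    have "isCont g z" "isCont (deriv g) z"
      using analytic_at_imp_isCont g_ana analytic_deriv[OF g_ana] by blast+
    then show ?thesis
      unfolding isCont_def by (intro tendsto_intros) (auto simp: add_nonneg_eq_0_iff)
  qed
  have "eventually (\<lambda>w. f analytic_on {w}) (at z)"
    using mero meromorphic_on_isolated_singularity isolated_singularity_at_altdef by blast
  moreover have "eventually (\<lambda>w. f w \<noteq> 0) (at z)"
    using pole non_zero_neighbour_pole by blast
  ultimately have "eventually (\<lambda>w. norm (deriv g w) / (1 + (norm (g w))\<^sup>2) =
                      norm (deriv f w) / (1 + (norm (f w))\<^sup>2)) (at z)"
  proof eventually_elim
    case (elim w)
    have "(f has_field_derivative deriv f w) (at w)"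
      using elim(1) analytic_on_imp_differentiable_at DERIV_deriv_iff_field_differentiable by blast
    then have "(g has_field_derivative - (inverse (f w) * deriv f w * inverse (f w))) (at w)"
      unfolding g_def using elim(2) by (rule DERIV_inverse')
    then have "deriv g w = - (inverse (f w) * deriv f w * inverse (f w))"
      by (rule DERIV_imp_deriv)
    then have 1: "norm (deriv g w) = norm (deriv f w) / (norm (f w))\<^sup>2"
      by (simp add: norm_mult norm_inverse norm_divide field_simps power2_eq_square)
    have "1 + (norm (g w))\<^sup>2 = (1 + (norm (f w))\<^sup>2) / (norm (f w))\<^sup>2"
      using elim(2) by (simp add: g_def norm_inverse norm_divide field_simps)
    with 1 show ?case
      using elim(2) by simp
  qed
  with lim have lim': "((\<lambda>w. norm (deriv f w) / (1 + (norm (f w))\<^sup>2)) \<longlongrightarrow>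
               norm (deriv g z) / (1 + (norm (g z))\<^sup>2)) (at z)"
    by (rule Lim_transform_eventually)
  then have eq: "spherical_deriv f z = norm (deriv g z) / (1 + (norm (g z))\<^sup>2)"
    using pole by (simp add: spherical_deriv_def tendsto_Lim)
  with lim' show "((\<lambda>w. norm (deriv f w) / (1 + (norm (f w))\<^sup>2)) \<longlongrightarrow> spherical_deriv f z) (at z)"
    by simp
  have "\<not> is_pole g z"
    using g_lim not_tendsto_and_filterlim_at_infinity[of "at z" g 0] by (auto simp: is_pole_def)
  with eq show "spherical_deriv f z = spherical_deriv (\<lambda>w. inverse (f w)) z"
    by (simp add: spherical_deriv_def g_def)
qed

text \<open>
  Meromorphic functions on the disc are represented by total functions: \<open>nicely_meromorphic_on\<close>
  (rather than \<open>meromorphic_on\<close>) rules out wrong values at removable singularities and fixes the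
  value at poles to be the dummy value 0. The values outside the disc are irrelevant.
\<close>

definition F_class :: "real \<Rightarrow> (complex \<Rightarrow> complex) set" where
  "F_class c = {f. f nicely_meromorphic_on ball 0 1 \<and> (\<forall>z\<in>ball 0 1. spherical_deriv f z \<ge> c)}"

end

theory Submission
  imports Defs
begin

text \<open>
  If \<open>f\<^sup>\<sharp> > 0\<close>, then the reciprocal of the spherical derivative splits into the moduli of two meromorphic
  functions: at points that are not poles,
  \<open>1 / f\<^sup>\<sharp> = |G\<^sub>1| + |G\<^sub>2|\<close> with \<open>G\<^sub>1 = f\<^sup>2 / f'\<close> and \<open>G\<^sub>2 = 1 / f'\<close>. If \<open>f\<^sup>\<sharp> \<ge> c\<close>, then both
  functions are bounded by \<open>1 / c\<close>, so that their singularities at the poles of \<open>f\<close> are removable and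
  they are holomorphic on the whole disc (\<open>reciprocal_density_decomposition\<close>).

  Rotations of the sphere preserve \<open>f\<^sup>\<sharp>\<close>, so one may assume \<open>f a = 0\<close> at the point \<open>a\<close> of interest. Let \<open>T\<close>
  be the disc automorphism with \<open>T 0 = a\<close> and \<open>T' 0 = \<delta> = 1 - |a|\<^sup>2\<close>. Then \<open>G\<^sub>1 (T w) = w\<^sup>2 k w\<close> has a double
  zero at \<open>0\<close>, with \<open>|k 0| = \<delta>\<^sup>2 s\<close> where \<open>s = f\<^sup>\<sharp> a\<close>, while \<open>|G\<^sub>2 (T 0)| = 1 / s\<close>. As in the Schwarz lemma, the
  maximum principle applied to \<open>u k + v (G\<^sub>2 \<circ> T)\<close> with suitable unimodular constants \<open>u\<close> and \<open>v\<close> removes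
  the factor \<open>w\<^sup>2\<close> from the bound \<open>|w\<^sup>2 k| + |G\<^sub>2 \<circ> T| \<le> 1 / c\<close>. At \<open>w = 0\<close> this gives

  \<open>\<delta>\<^sup>2 s + 1 / s \<le> 1 / c\<close>,

  and solving this quadratic inequality for \<open>s\<close> gives the two bounds.

  In the case of equality, \<open>k\<close> and \<open>G\<^sub>2 \<circ> T\<close> are constant. Then \<open>f'\<close> is constant, so \<open>f\<close> is affine, and
  comparing \<open>G\<^sub>1\<close> with a multiple of \<open>(T\<^sup>-\<^sup>1)\<^sup>2\<close> shows that \<open>T\<^sup>-\<^sup>1\<close> is affine near \<open>a\<close>, that is, \<open>a = 0\<close>.
  Conversely, for a root \<open>s\<close> of the quadratic with \<open>\<delta> = 1\<close> the function \<open>z \<mapsto> s z\<close> is extremal at \<open>0\<close>.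
\<close>

section \<open>A Schwarz lemma for a sum of two moduli\<close>

lemma exists_unit_rotation:
  obtains u :: complex where "norm u = 1" "u * x = of_real (norm x)"
proof (cases "x = 0")
  case True
  with that[of 1] show ?thesis by simp
next
  case False
  show ?thesis
  proof (rule that[of "cnj (sgn x)"])
    show "norm (cnj (sgn x)) = 1"
      using False by (simp add: norm_sgn)
    show "cnj (sgn x) * x = of_real (norm x)"
      using False complex_norm_square[of x]
      by (simp add: sgn_div_norm scaleR_conv_of_real field_simps power2_eq_square)
  qed
qed

text \<open>
  The Schwarz lemma for two functions at once. A single holomorphic function sees both moduli: rotate \<open>k\<close>
  and \<open>\<psi>\<close> so that both values at the given point \<open>z\<close> are nonnegative, and apply the maximum principle on
  the disc of radius \<open>r\<close> to \<open>r\<^sup>2 u k + v \<psi>\<close>, whose modulus on the circle is controlled by the hypothesis;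
  finally let \<open>r\<close> tend to \<open>1\<close>.
\<close>

lemma norm_sum_le_of_weighted_bound:
  fixes k \<psi> :: "complex \<Rightarrow> complex"
  assumes k: "k holomorphic_on ball 0 1" and \<psi>: "\<psi> holomorphic_on ball 0 1"
    and bound: "\<And>z. z \<in> ball 0 1 \<Longrightarrow> (norm z)\<^sup>2 * norm (k z) + norm (\<psi> z) \<le> M"
    and z: "z \<in> ball 0 1"
  shows "norm (k z) + norm (\<psi> z) \<le> M"
proof -
  obtain u where u: "norm u = 1" "u * k z = of_real (norm (k z))"
    by (rule exists_unit_rotation)
  obtain v where v: "norm v = 1" "v * \<psi> z = of_real (norm (\<psi> z))"
    by (rule exists_unit_rotation)
  have le: "r\<^sup>2 * norm (k z) + norm (\<psi> z) \<le> M" if r: "norm z < r" "r < 1" for r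
  proof -
    define F where "F = (\<lambda>w. of_real (r\<^sup>2) * (u * k w) + v * \<psi> w)"
    have r0: "r > 0"
      using r norm_ge_zero[of z] by linarith
    have hol: "F holomorphic_on cball 0 r"
      unfolding F_def using r by (intro holomorphic_intros holomorphic_on_subset[OF k] holomorphic_on_subset[OF \<psi>]) auto
    have "norm (F z) \<le> M"
    proof (rule maximum_modulus_frontier[where f = F and S = "cball 0 r" and \<xi> = z])
      show "F holomorphic_on interior (cball 0 r)"
        using hol by (rule holomorphic_on_subset) auto
      show "continuous_on (closure (cball 0 r)) F"
        using hol by (simp add: holomorphic_on_imp_continuous_on)
      fix w assume "w \<in> frontier (cball (0::complex) r)"
      then have w: "norm w = r"
        using r0 by simp
      have "norm (F w) \<le> norm (of_real (r\<^sup>2) * (u * k w)) + norm (v * \<psi> w)"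
        unfolding F_def by (rule norm_triangle_ineq)
      also have "\<dots> = (norm w)\<^sup>2 * norm (k w) + norm (\<psi> w)"
        using u v w r0 by (simp add: norm_mult norm_power)
      also have "\<dots> \<le> M"
        using w r by (intro bound) auto
      finally show "norm (F w) \<le> M" .
    qed (use r in auto)
    also have "F z = of_real (r\<^sup>2 * norm (k z) + norm (\<psi> z))"
      unfolding F_def u v by simp
    also have "norm \<dots> = r\<^sup>2 * norm (k z) + norm (\<psi> z)"
      by (simp only: norm_of_real) simp
    finally show ?thesis .
  qed
  have lim: "((\<lambda>r. r\<^sup>2 * norm (k z) + norm (\<psi> z)) \<longlongrightarrow> 1\<^sup>2 * norm (k z) + norm (\<psi> z)) (at_left 1)"
    by (intro tendsto_intros)
  have "eventually (\<lambda>r. r\<^sup>2 * norm (k z) + norm (\<psi> z) \<le> M) (at_left 1)"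
    using z by (intro eventually_at_leftI[of "norm z"] le) auto
  from tendsto_upperbound[OF lim this] show ?thesis
    by simp
qed

lemma real_valued_holomorphic_constant:
  assumes hol: "f holomorphic_on S" and S: "open S" "connected S"
    and real: "\<And>z. z \<in> S \<Longrightarrow> Im (f z) = 0"
  shows "f constant_on S"
proof (rule ccontr)
  assume not_const: "\<not> f constant_on S"
  then have op: "open (f ` S)"
    using open_mapping_thm[OF hol S S(1) order_refl] by blast
  obtain z where z: "z \<in> S"
    using not_const by (auto simp: constant_on_def)
  with op obtain e where e: "e > 0" "ball (f z) e \<subseteq> f ` S"
    by (meson image_eqI openE)
  have "f z + \<i> * of_real (e / 2) \<in> ball (f z) e"
    using e by (simp add: dist_norm norm_mult)
  then obtain w where w: "w \<in> S" "f w = f z + \<i> * of_real (e / 2)"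
    using e by (metis imageE subsetD)
  then show False
    using real[of w] real[of z] z e by simp
qed

text \<open>
  A rigid form of the strong maximum principle: not only is the combination \<open>u k + v \<psi>\<close> constant that is
  aligned at \<open>0\<close>, but so is each function.
\<close>

lemma constant_of_norm_sum_maximal:
  fixes k \<psi> :: "complex \<Rightarrow> complex"
  assumes k: "k holomorphic_on ball 0 1" and \<psi>: "\<psi> holomorphic_on ball 0 1"
    and bound: "\<And>z. z \<in> ball 0 1 \<Longrightarrow> norm (k z) + norm (\<psi> z) \<le> norm (k 0) + norm (\<psi> 0)"
    and z: "z \<in> ball 0 1"
  shows "k z = k 0" "\<psi> z = \<psi> 0"
proof -
  obtain u where u: "norm u = 1" "u * k 0 = of_real (norm (k 0))"
    by (rule exists_unit_rotation)
  obtain v where v: "norm v = 1" "v * \<psi> 0 = of_real (norm (\<psi> 0))"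
    by (rule exists_unit_rotation)
  define F where "F = (\<lambda>w. u * k w + v * \<psi> w)"
  have F0: "F 0 = of_real (norm (k 0) + norm (\<psi> 0))"
    unfolding F_def u v by simp
  have F_const: "F constant_on ball 0 1"
  proof (rule maximum_modulus_principle[of F "ball 0 1" "ball 0 1" 0])
    show "F holomorphic_on ball 0 1"
      unfolding F_def by (intro holomorphic_intros k \<psi>)
    fix w :: complex assume w: "w \<in> ball 0 1"
    have "norm (F w) \<le> norm (u * k w) + norm (v * \<psi> w)"
      unfolding F_def by (rule norm_triangle_ineq)
    also have "\<dots> \<le> norm (k 0) + norm (\<psi> 0)"
      using bound[OF w] u v by (simp add: norm_mult)
    also have "\<dots> = norm (F 0)"
      unfolding F0 by (simp only: norm_of_real) simp
    finally show "norm (F w) \<le> norm (F 0)" .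
  qed auto
  \<comment> \<open>The real parts of the two summands of \<open>F\<close> must be as large as their moduli permit, so both
    summands are nonnegative reals, and a real-valued holomorphic function is constant.\<close>
  have real: "Im (u * k w) = 0" "Im (v * \<psi> w) = 0" if w: "w \<in> ball 0 1" for w
  proof -
    have "F w = F 0"
      using F_const w by (auto simp: constant_on_def)
    then have sum: "u * k w + v * \<psi> w = of_real (norm (k 0) + norm (\<psi> 0))"
      unfolding F0 by (simp add: F_def)
    have nrm: "norm (u * k w) = norm (k w)" "norm (v * \<psi> w) = norm (\<psi> w)"
      using u v by (simp_all add: norm_mult)
    have "Re (u * k w) + Re (v * \<psi> w) = norm (k 0) + norm (\<psi> 0)"
      using arg_cong[OF sum, of Re] by simp
    then have "Re (u * k w) = norm (u * k w)" "Re (v * \<psi> w) = norm (v * \<psi> w)"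
      using bound[OF w] nrm complex_Re_le_cmod[of "u * k w"] complex_Re_le_cmod[of "v * \<psi> w"]
      by linarith+
    then show "Im (u * k w) = 0" "Im (v * \<psi> w) = 0"
      using cmod_power2[of "u * k w"] cmod_power2[of "v * \<psi> w"] by simp_all
  qed
  have "(\<lambda>w. u * k w) constant_on ball 0 1" "(\<lambda>w. v * \<psi> w) constant_on ball 0 1"
    by (rule real_valued_holomorphic_constant; use real in \<open>auto intro!: holomorphic_intros k \<psi>\<close>)+
  then have "u * k z = u * k 0" "v * \<psi> z = v * \<psi> 0"
    using z centre_in_ball[of "0::complex" 1] unfolding constant_on_def by (metis zero_less_one)+
  moreover have "u \<noteq> 0" "v \<noteq> 0"
    using u(1) v(1) by auto
  ultimately show "k z = k 0" "\<psi> z = \<psi> 0"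
    by auto
qed

section \<open>Functions with a lower bound on the spherical derivative\<close>

lemma bounded_meromorphic_removable:
  assumes f: "f meromorphic_on {z}" and bd: "eventually (\<lambda>w. norm (f w) \<le> M) (at z)"
  shows "remove_sings f analytic_on {z}" "f \<midarrow>z\<rightarrow> remove_sings f z"
proof -
  have "\<not> is_pole f z"
  proof
    assume "is_pole f z"
    then have "eventually (\<lambda>w. norm (f w) \<ge> M + 1) (at z)"
      by (auto simp: is_pole_def filterlim_at_infinity_conv_norm_at_top filterlim_at_top)
    with bd have "eventually (\<lambda>w. False) (at z)"
      by eventually_elim simp
    then show False
      by simp
  qed
  with meromorphic_on_not_essential[OF f] obtain L where L: "f \<midarrow>z\<rightarrow> L"
    by (auto simp: not_essential_def)
  show "remove_sings f analytic_on {z}"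
    using meromorphic_on_isolated_singularity[OF f] L by (rule remove_sings_analytic_at)
  show "f \<midarrow>z\<rightarrow> remove_sings f z"
    using L remove_sings_eqI[OF L] by simp
qed

text \<open>
  The lower bound is imposed in punctured neighbourhoods only. This leaves out the poles, so the notion is
  stable under rotations of the sphere without regard to the values that are assigned to poles.
\<close>

definition spherically_expanding :: "real \<Rightarrow> (complex \<Rightarrow> complex) \<Rightarrow> bool" where
  "spherically_expanding c g \<longleftrightarrow> g meromorphic_on ball 0 1 \<and>
     (\<forall>z\<in>ball 0 1. \<forall>\<^sub>F w in at z. c * (1 + (norm (g w))\<^sup>2) \<le> norm (deriv g w))"

text \<open>
  Off a discrete set the sum of the two moduli is \<open>(|g|\<^sup>2 + 1) / |g'|\<close>, the reciprocal of the spherical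
  derivative, hence at most \<open>1 / c\<close>. A bounded singularity is removable, and the bound persists in the limit.
\<close>

lemma reciprocal_density_decomposition:
  fixes g :: "complex \<Rightarrow> complex"
  assumes c: "c > 0" and g: "spherically_expanding c g"
  defines "G1 \<equiv> remove_sings (\<lambda>w. (g w)\<^sup>2 / deriv g w)"
    and "G2 \<equiv> remove_sings (\<lambda>w. 1 / deriv g w)"
  shows "G1 holomorphic_on ball 0 1" "G2 holomorphic_on ball 0 1"
    "\<And>z. z \<in> ball 0 1 \<Longrightarrow> norm (G1 z) + norm (G2 z) \<le> 1 / c"
proof -
  define H1 where "H1 = (\<lambda>w. (g w)\<^sup>2 / deriv g w)"
  define H2 where "H2 = (\<lambda>w. 1 / deriv g w)"
  have *: "G1 analytic_on {z} \<and> G2 analytic_on {z} \<and> norm (G1 z) + norm (G2 z) \<le> 1 / c"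
    if z: "z \<in> ball 0 1" for z
  proof -
    have mero: "g meromorphic_on {z}"
      using g z meromorphic_on_subset unfolding spherically_expanding_def by blast
    have mero_H: "H1 meromorphic_on {z}" "H2 meromorphic_on {z}"
      unfolding H1_def H2_def by (intro meromorphic_intros mero)+
    have ev: "eventually (\<lambda>w. norm (H1 w) + norm (H2 w) \<le> 1 / c) (at z)"
      using g z unfolding spherically_expanding_def
    proof (elim conjE ballE[of _ _ z])
      assume "\<forall>\<^sub>F w in at z. c * (1 + (norm (g w))\<^sup>2) \<le> norm (deriv g w)"
      then show ?thesis
      proof eventually_elim
        case (elim w)
        have "0 < c * (1 + (norm (g w))\<^sup>2)"
          using c by (simp add: add_pos_nonneg)
        with elim have pos: "norm (deriv g w) > 0"
          by linarith
        have "norm (H1 w) + norm (H2 w) = (1 + (norm (g w))\<^sup>2) / norm (deriv g w)"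
          by (simp add: H1_def H2_def norm_divide norm_power add_divide_distrib)
        also have "\<dots> \<le> 1 / c"
          using elim pos c by (simp add: field_simps)
        finally show ?case .
      qed
    qed auto
    have bd: "\<forall>\<^sub>F w in at z. norm (H1 w) \<le> 1 / c" "\<forall>\<^sub>F w in at z. norm (H2 w) \<le> 1 / c"
      using ev by (eventually_elim; smt (verit) norm_ge_zero)+
    note r1 = bounded_meromorphic_removable[OF mero_H(1) bd(1)]
    note r2 = bounded_meromorphic_removable[OF mero_H(2) bd(2)]
    have "((\<lambda>w. norm (H1 w) + norm (H2 w)) \<longlongrightarrow> norm (G1 z) + norm (G2 z)) (at z)"
      using r1(2) r2(2) unfolding G1_def G2_def H1_def H2_def by (intro tendsto_intros)
    from tendsto_upperbound[OF this ev]
    have "norm (G1 z) + norm (G2 z) \<le> 1 / c"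
      by simp
    with r1(1) r2(1) show ?thesis
      unfolding G1_def G2_def H1_def H2_def by blast
  qed
  show "G1 holomorphic_on ball 0 1" "G2 holomorphic_on ball 0 1"
    using * by (meson analytic_imp_holomorphic analytic_on_analytic_at)+
  show "norm (G1 z) + norm (G2 z) \<le> 1 / c" if "z \<in> ball 0 1" for z
    using *[OF that] by blast
qed

section \<open>The bound at a zero of the function\<close>

lemma
  fixes a :: complex
  assumes "norm a < 1"
  shows disc_automorphism_0: "Moebius_function 0 (- a) 0 = a"
    and disc_automorphism_in_disc: "z \<in> ball 0 1 \<Longrightarrow> Moebius_function 0 (- a) z \<in> ball 0 1"
    and disc_automorphism_inverse: "z \<in> ball 0 1 \<Longrightarrow> Moebius_function 0 (-a) (Moebius_function 0 a z) = z"
    and disc_automorphism_deriv_0: "(Moebius_function 0 (- a) has_field_derivative of_real (1 - (norm a)\<^sup>2)) (at 0)"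
proof -
  show "Moebius_function 0 (- a) 0 = a"
    by (simp add: Moebius_function_of_zero)
  show "z \<in> ball 0 1 \<Longrightarrow> Moebius_function 0 (- a) z \<in> ball 0 1"
    using Moebius_function_norm_lt_1[of "- a" z] assms by simp
  show "z \<in> ball 0 1 \<Longrightarrow> Moebius_function 0 (-a) (Moebius_function 0 a z) = z"
    using assms by (intro Moebius_function_compose) auto
  show "(Moebius_function 0 (- a) has_field_derivative of_real (1 - (norm a)\<^sup>2)) (at 0)"
    unfolding Moebius_function_simple[abs_def] complex_norm_square of_real_diff of_real_1
    by (auto intro!: derivative_eq_intros)
qed

text \<open>
  The leading coefficient of \<open>(g \<circ> T)\<^sup>2\<close> at its double zero: it determines the value to be filled in at
  \<open>0\<close> when the zero of \<open>(g\<^sup>2 / g') \<circ> T\<close> is divided out.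
\<close>

lemma power2_quotient_limit:
  fixes g T :: "complex \<Rightarrow> complex"
  assumes T: "(T has_field_derivative d) (at 0)" "T 0 = a"
    and g: "(g has_field_derivative g') (at a)" "g a = 0"
  shows "(\<lambda>w. (g (T w))\<^sup>2 / w\<^sup>2) \<midarrow>0\<rightarrow> (g' * d)\<^sup>2"
proof -
  have "(g \<circ> T has_field_derivative g' * d) (at 0)"
    using T g by (intro DERIV_chain) auto
  then have "(\<lambda>w. (g (T w) - g (T 0)) / (w - 0)) \<midarrow>0\<rightarrow> g' * d"
    by (simp add: has_field_derivative_iff o_def)
  then have "(\<lambda>w. (g (T w) / w)\<^sup>2) \<midarrow>0\<rightarrow> (g' * d)\<^sup>2"
    using T g by (intro tendsto_intros) simp
  then show ?thesis
    by (simp add: power_divide)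
qed

text \<open>
  At a zero of \<open>g\<close> the spherical derivative is \<open>|g'|\<close>, and \<open>G1\<close> vanishes there to second order. The
  Schwarz lemma above, applied after moving the zero to the origin, is the whole proof of the inequality.
\<close>

lemma spherically_expanding_bound_at_zero:
  fixes g :: "complex \<Rightarrow> complex"
  assumes c: "c > 0" and g: "spherically_expanding c g"
    and a: "a \<in> ball 0 1" and ana: "g analytic_on {a}" and g0: "g a = 0"
  defines "s \<equiv> norm (deriv g a)" and "\<delta> \<equiv> 1 - (norm a)\<^sup>2"
  shows "c * (1 + \<delta>\<^sup>2 * s\<^sup>2) \<le> s" "c * (1 + \<delta>\<^sup>2 * s\<^sup>2) = s \<Longrightarrow> a = 0"
proof -
  define G1 where "G1 = remove_sings (\<lambda>w. (g w)\<^sup>2 / deriv g w)"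
  define G2 where "G2 = remove_sings (\<lambda>w. 1 / deriv g w)"
  have G: "G1 holomorphic_on ball 0 1" "G2 holomorphic_on ball 0 1"
    "\<And>z. z \<in> ball 0 1 \<Longrightarrow> norm (G1 z) + norm (G2 z) \<le> 1 / c"
    using reciprocal_density_decomposition[OF c g] unfolding G1_def G2_def by blast+
  have ana': "deriv g analytic_on {a}"
    using ana by (rule analytic_deriv)
  have s: "s > 0"
  proof -
    have "((\<lambda>w. norm (deriv g w)) \<longlongrightarrow> s) (at a)"
      unfolding s_def using analytic_at_imp_isCont[OF ana'] by (intro tendsto_norm isContD)
    moreover have "\<forall>\<^sub>F w in at a. c * (1 + (norm (g w))\<^sup>2) \<le> norm (deriv g w)"
      using g a unfolding spherically_expanding_def by blast
    then have "\<forall>\<^sub>F w in at a. c \<le> norm (deriv g w)"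
    proof eventually_elim
      case (elim w)
      have "c * 1 \<le> c * (1 + (norm (g w))\<^sup>2)"
        using c by (intro mult_left_mono) auto
      with elim show ?case by simp
    qed
    ultimately have "c \<le> s"
      by (intro tendsto_lowerbound) auto
    with c show ?thesis by simp
  qed
  have \<delta>: "\<delta> > 0"
    using a by (simp add: \<delta>_def power_less_one_iff abs_square_less_1)
  have dg0: "deriv g a \<noteq> 0"
    using s by (auto simp: s_def)
  obtain e where e: "e > 0" "g holomorphic_on ball a e" "\<And>w. w \<in> ball a e \<Longrightarrow> deriv g w \<noteq> 0"
    "ball a e \<subseteq> ball 0 1"
  proof -
    obtain e1 where e1: "e1 > 0" "g holomorphic_on ball a e1"
      using ana unfolding analytic_on_def by auto
    have "(deriv g \<longlongrightarrow> deriv g a) (nhds a)"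
      using analytic_at_imp_isCont[OF ana'] by (simp add: isCont_def tendsto_at_iff_tendsto_nhds)
    then have "\<forall>\<^sub>F w in nhds a. deriv g w \<noteq> 0"
      using dg0 by (rule tendsto_imp_eventually_ne)
    then obtain e2 where e2: "e2 > 0" "\<And>w. dist w a < e2 \<Longrightarrow> deriv g w \<noteq> 0"
      unfolding eventually_nhds_metric by blast
    obtain e3 where e3: "e3 > 0" "ball a e3 \<subseteq> ball 0 1"
      using a open_contains_ball open_ball by blast
    show thesis
    proof (rule that[of "min e1 (min e2 e3)"])
      show "g holomorphic_on ball a (min e1 (min e2 e3))"
        using e1(2) by (rule holomorphic_on_subset) auto
    qed (use e1 e2 e3 in \<open>auto simp: dist_commute\<close>)
  qed
  have near: "G1 w = (g w)\<^sup>2 / deriv g w" "G2 w = 1 / deriv g w" if w: "w \<in> ball a e" for w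
  proof -
    have "g analytic_on {w}"
      using e(2) w by (meson analytic_at open_ball)
    then show "G1 w = (g w)\<^sup>2 / deriv g w" "G2 w = 1 / deriv g w"
      unfolding G1_def G2_def using e(3)[OF w]
      by (intro remove_sings_at_analytic analytic_intros analytic_deriv; simp)+
  qed
  define T where "T = Moebius_function 0 (- a)"
  have a1: "norm a < 1"
    using a by simp
  note T = disc_automorphism_0[OF a1, folded T_def] disc_automorphism_in_disc[OF a1, folded T_def]
    disc_automorphism_inverse[OF a1, folded T_def] disc_automorphism_deriv_0[OF a1, folded T_def, folded \<delta>_def]
  have T_hol: "T holomorphic_on ball 0 1"
    unfolding T_def using a1 by (intro Moebius_function_holomorphic) simp
  define \<psi> where "\<psi> = G2 \<circ> T"
  \<comment> \<open>The quotient of \<open>G1 \<circ> T\<close> by \<open>w\<^sup>2\<close>; the value at \<open>0\<close> is the limit of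
    \<open>(g (T w) / w)\<^sup>2 / deriv g (T w)\<close>.\<close>
  define k where "k = (\<lambda>w. if w = 0 then deriv g a * (of_real \<delta>)\<^sup>2 else G1 (T w) / w\<^sup>2)"
  have \<psi>_hol: "\<psi> holomorphic_on ball 0 1"
    unfolding \<psi>_def using T_hol G(2) by (rule holomorphic_on_compose_gen) (use T(2) in auto)
  have G1T_hol: "G1 \<circ> T holomorphic_on ball 0 1"
    using T_hol G(1) by (rule holomorphic_on_compose_gen) (use T(2) in auto)
  have k_hol: "k holomorphic_on ball 0 1"
  proof (rule no_isolated_singularity'[where K = "{0}"])
    have "(\<lambda>w. (G1 \<circ> T) w / w\<^sup>2) holomorphic_on ball 0 1 - {0}"
      by (intro holomorphic_intros holomorphic_on_subset[OF G1T_hol]) auto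
    then show "k holomorphic_on ball 0 1 - {0}"
      by (rule holomorphic_transform) (auto simp: k_def)
    fix z :: complex assume "z \<in> {0}"
    then have z: "z = 0" by simp
    have T_lim: "T \<midarrow>0\<rightarrow> a"
      using T(1,4) DERIV_isCont isContD by metis
    have "(g has_field_derivative deriv g a) (at a)"
      using ana analytic_on_imp_differentiable_at DERIV_deriv_iff_field_differentiable by blast
    from power2_quotient_limit[OF T(4,1) this g0]
    have "(\<lambda>w. (g (T w))\<^sup>2 / w\<^sup>2) \<midarrow>0\<rightarrow> (deriv g a * of_real \<delta>)\<^sup>2" .
    moreover have "(\<lambda>w. deriv g (T w)) \<midarrow>0\<rightarrow> deriv g a"
      using analytic_at_imp_isCont[OF ana'] T_lim by (rule isCont_tendsto_compose)
    ultimately have "(\<lambda>w. (g (T w))\<^sup>2 / w\<^sup>2 / deriv g (T w)) \<midarrow>0\<rightarrow> (deriv g a * of_real \<delta>)\<^sup>2 / deriv g a"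
      using dg0 by (intro tendsto_divide)
    also have "(deriv g a * of_real \<delta>)\<^sup>2 / deriv g a = k 0"
      using dg0 by (simp add: k_def power2_eq_square)
    finally have lim: "(\<lambda>w. (g (T w))\<^sup>2 / w\<^sup>2 / deriv g (T w)) \<midarrow>0\<rightarrow> k 0" .
    have "\<forall>\<^sub>F w in at 0. T w \<in> ball a e"
      using T_lim e(1) by (intro topological_tendstoD) auto
    then have "\<forall>\<^sub>F w in at 0. (g (T w))\<^sup>2 / w\<^sup>2 / deriv g (T w) = k w"
      using eventually_neq_at_within[of "0::complex" 0 UNIV]
      by eventually_elim (simp add: k_def near)
    with lim have "k \<midarrow>0\<rightarrow> k 0"
      by (rule Lim_transform_eventually)
    then show "(k \<longlongrightarrow> k z) (at z within ball 0 1)"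
      unfolding z by (rule tendsto_within_subset) simp
  qed auto
  have norm0: "norm (k 0) = \<delta>\<^sup>2 * s" "norm (\<psi> 0) = 1 / s"
    using near(2)[of a] e(1) T(1) by (simp_all add: k_def \<psi>_def s_def norm_mult norm_power norm_divide)
  have "(norm w)\<^sup>2 * norm (k w) + norm (\<psi> w) \<le> 1 / c" if w: "w \<in> ball 0 1" for w
  proof (cases "w = 0")
    case True
    then show ?thesis
      using G(3)[OF a] T(1) near(1)[of a] e(1) g0 by (simp add: \<psi>_def)
  next
    case False
    then show ?thesis
      using G(3)[OF T(2)[OF w]] by (simp add: \<psi>_def k_def norm_divide norm_power)
  qed
  note sum_le = norm_sum_le_of_weighted_bound[OF k_hol \<psi>_hol this]
  have "\<delta>\<^sup>2 * s + 1 / s \<le> 1 / c"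
    using sum_le[of 0] norm0 by simp
  then show "c * (1 + \<delta>\<^sup>2 * s\<^sup>2) \<le> s"
    using s c by (simp add: field_simps power2_eq_square)
  show "a = 0" if eq: "c * (1 + \<delta>\<^sup>2 * s\<^sup>2) = s"
  proof -
    have "\<delta>\<^sup>2 * s + 1 / s = 1 / c"
      using s c eq by (simp add: field_simps power2_eq_square)
    with sum_le norm0 have le: "norm (k w) + norm (\<psi> w) \<le> norm (k 0) + norm (\<psi> 0)"
      if "w \<in> ball 0 1" for w using that by simp
    have const: "k w = k 0" "\<psi> w = \<psi> 0" if "w \<in> ball 0 1" for w
      using constant_of_norm_sum_maximal[OF k_hol \<psi>_hol le that] by auto
    \<comment> \<open>The inverse of \<open>T\<close> carries the constancy of \<open>k\<close> and \<open>\<psi>\<close> back to \<open>g\<close>: near \<open>a\<close>, the function \<open>g\<close>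
      is linear in \<open>w - a\<close> and its square is a multiple of \<open>m\<^sup>2\<close>.\<close>
    define m where "m = Moebius_function 0 a"
    have m_in: "m w \<in> ball 0 1" if "w \<in> ball 0 1" for w
      using Moebius_function_norm_lt_1[of a w 0] that a1 by (simp add: m_def)
    have dg: "deriv g w = deriv g a" if w: "w \<in> ball a e" for w
    proof -
      have w1: "w \<in> ball 0 1"
        using w e(4) by blast
      have "\<psi> (m w) = \<psi> 0"
        using const m_in w1 by blast
      then have "G2 w = G2 a"
        using T(1,3) w1 by (simp add: \<psi>_def m_def)
      then show ?thesis
        using near(2)[OF w] near(2)[of a] e(1) by simp
    qed
    have g_eq: "g w = deriv g a * (w - a)" if w: "w \<in> ball a e" for w
    proof -
      have "\<exists>C. \<forall>x\<in>ball a e. g x - deriv g a * (x - a) = C"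
      proof (rule has_field_derivative_zero_constant)
        fix x assume x: "x \<in> ball a e"
        have "(g has_field_derivative deriv g a) (at x)"
          using e(2) x dg[OF x] holomorphic_derivI[OF e(2) open_ball x, of UNIV] by simp
        then have "((\<lambda>x. g x - deriv g a * (x - a)) has_field_derivative 0) (at x)"
          by (auto intro!: derivative_eq_intros)
        then show "((\<lambda>x. g x - deriv g a * (x - a)) has_field_derivative 0) (at x within ball a e)"
          by (rule has_field_derivative_at_within)
      qed auto
      then obtain C where C: "\<And>x. x \<in> ball a e \<Longrightarrow> g x - deriv g a * (x - a) = C"
        by blast
      from C[of a] C[OF w] e(1) g0 show ?thesis by simp
    qed
    have sq: "(1 - cnj a * w)\<^sup>2 = (of_real \<delta>)\<^sup>2" if w: "w \<in> ball a e" "w \<noteq> a" for w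
    proof -
      have w1: "w \<in> ball 0 1"
        using w e(4) by blast
      have den: "1 - cnj a * w \<noteq> 0"
      proof
        assume "1 - cnj a * w = 0"
        then have "norm (cnj a * w) = 1"
          by (metis eq_iff_diff_eq_0 norm_one)
        moreover have "norm a * norm w < 1 * 1"
          using a1 w1 by (intro mult_strict_mono') auto
        ultimately show False
          by (simp add: norm_mult)
      qed
      have m: "m w = (w - a) / (1 - cnj a * w)"
        by (simp add: m_def Moebius_function_simple)
      have m0: "m w \<noteq> 0"
        using den w by (simp add: m)
      have "k (m w) = k 0"
        using const m_in w1 by blast
      then have "G1 w = deriv g a * (of_real \<delta>)\<^sup>2 * (m w)\<^sup>2"
        using T(3)[OF w1] m0 by (simp add: k_def m_def[symmetric] field_simps)
      moreover have "G1 w = deriv g a * (w - a)\<^sup>2"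
        using near(1)[OF w(1)] dg[OF w(1)] g_eq[OF w(1)] dg0 by (simp add: power2_eq_square)
      ultimately have "deriv g a * (w - a)\<^sup>2 = deriv g a * ((of_real \<delta>)\<^sup>2 * (w - a)\<^sup>2 / (1 - cnj a * w)\<^sup>2)"
        by (simp add: m power_divide)
      then have "(w - a)\<^sup>2 = (of_real \<delta>)\<^sup>2 * (w - a)\<^sup>2 / (1 - cnj a * w)\<^sup>2"
        using dg0 by (simp only: mult_cancel_left) simp
      then have "(w - a)\<^sup>2 * (1 - cnj a * w)\<^sup>2 = (w - a)\<^sup>2 * (of_real \<delta>)\<^sup>2"
        using den by (simp add: eq_divide_eq mult.commute)
      then show ?thesis
        using w(2) by (simp only: mult_cancel_left) simp
    qed
    \<comment> \<open>The function \<open>(1 - cnj a * w)\<^sup>2\<close> is constant on the punctured disc, so its derivative vanishes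
      at any point \<open>b\<close> of it, which forces \<open>a = 0\<close>.\<close>
    define b where "b = a + of_real (e / 2)"
    have b: "b \<in> ball a e - {a}"
      using e(1) by (simp add: b_def dist_norm)
    have "((\<lambda>w. (1 - cnj a * w)\<^sup>2) has_field_derivative 0) (at b)"
    proof (rule has_field_derivative_transform_within_open)
      show "((\<lambda>w. (of_real \<delta>)\<^sup>2) has_field_derivative 0) (at b)"
        by simp
      show "b \<in> ball a e - {a}" by fact
    qed (use sq in auto)
    moreover have "((\<lambda>w. (1 - cnj a * w)\<^sup>2) has_field_derivative 2 * (1 - cnj a * b) * (- cnj a)) (at b)"
      by (auto intro!: derivative_eq_intros)
    ultimately have "2 * (1 - cnj a * b) * (- cnj a) = 0"
      by (metis DERIV_unique)
    moreover have "1 - cnj a * b \<noteq> 0"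
      using sq[of b] b \<delta> by auto
    ultimately show "a = 0"
      by simp
  qed
qed

section \<open>Rotations of the sphere\<close>

text \<open>
  The maps \<open>p \<mapsto> (\<alpha> p + \<beta>) / (cnj \<alpha> - cnj \<beta> p)\<close> with \<open>|\<alpha>|\<^sup>2 + |\<beta>|\<^sup>2 = 1\<close> are the rotations of the sphere.
  Numerator and denominator of the spherical derivative both pick up the factor
  \<open>1 / |cnj \<alpha> - cnj \<beta> f|\<^sup>2\<close>, which cancels.
\<close>

lemma sphere_rotation_density:
  fixes f :: "complex \<Rightarrow> complex"
  assumes f: "(f has_field_derivative f') (at z)"
    and unit: "(norm \<alpha>)\<^sup>2 + (norm \<beta>)\<^sup>2 = 1" and den: "cnj \<alpha> - cnj \<beta> * f z \<noteq> 0"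
  shows "((\<lambda>w. (\<alpha> * f w + \<beta>) / (cnj \<alpha> - cnj \<beta> * f w)) has_field_derivative
            f' / (cnj \<alpha> - cnj \<beta> * f z)\<^sup>2) (at z)" (is ?deriv)
    and "1 + (norm ((\<alpha> * f z + \<beta>) / (cnj \<alpha> - cnj \<beta> * f z)))\<^sup>2 =
            (1 + (norm (f z))\<^sup>2) / (norm (cnj \<alpha> - cnj \<beta> * f z))\<^sup>2" (is ?norm)
proof -
  have one: "\<alpha> * cnj \<alpha> + \<beta> * cnj \<beta> = 1"
    using arg_cong[OF unit, of complex_of_real] unfolding of_real_add complex_norm_square of_real_1 .
  have "((\<lambda>w. (\<alpha> * f w + \<beta>) / (cnj \<alpha> - cnj \<beta> * f w)) has_field_derivative
          (\<alpha> * f' * (cnj \<alpha> - cnj \<beta> * f z) - (\<alpha> * f z + \<beta>) * (- (cnj \<beta> * f'))) /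
          ((cnj \<alpha> - cnj \<beta> * f z) * (cnj \<alpha> - cnj \<beta> * f z))) (at z)"
    using f den by (auto intro!: derivative_eq_intros)
  also have "\<alpha> * f' * (cnj \<alpha> - cnj \<beta> * f z) - (\<alpha> * f z + \<beta>) * (- (cnj \<beta> * f')) =
      (\<alpha> * cnj \<alpha> + \<beta> * cnj \<beta>) * f'"
    by (simp add: algebra_simps)
  finally show ?deriv
    unfolding one by (simp add: power2_eq_square)
  have "complex_of_real ((norm (cnj \<alpha> - cnj \<beta> * f z))\<^sup>2 + (norm (\<alpha> * f z + \<beta>))\<^sup>2) =
      (\<alpha> * cnj \<alpha> + \<beta> * cnj \<beta>) * (1 + f z * cnj (f z))"
    unfolding of_real_add complex_norm_square by (simp add: algebra_simps)
  also have "\<dots> = complex_of_real (1 + (norm (f z))\<^sup>2)"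
    unfolding one of_real_add complex_norm_square by simp
  finally have "(norm (cnj \<alpha> - cnj \<beta> * f z))\<^sup>2 + (norm (\<alpha> * f z + \<beta>))\<^sup>2 = 1 + (norm (f z))\<^sup>2"
    unfolding of_real_eq_iff .
  then show ?norm
    using den by (simp add: norm_divide power_divide field_simps)
qed

lemma eventually_const_imp_deriv_0:
  assumes "\<forall>\<^sub>F w in at z. f w = p"
  shows "\<forall>\<^sub>F w in at z. deriv f w = 0"
proof -
  obtain S where S: "open S" "z \<in> S" "\<And>w. w \<in> S \<Longrightarrow> w \<noteq> z \<Longrightarrow> f w = p"
    using assms unfolding eventually_at_topological by blast
  have "deriv f w = 0" if w: "w \<in> S - {z}" for w
  proof -
    have "\<forall>\<^sub>F x in nhds w. x \<in> S - {z}"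
      using S(1) w by (intro eventually_nhds_in_open) auto
    then have "\<forall>\<^sub>F x in nhds w. f x = p"
      by eventually_elim (use S(3) in auto)
    then have "deriv f w = deriv (\<lambda>_. p) w"
      by (rule deriv_cong_ev) simp
    then show ?thesis by simp
  qed
  moreover have "\<forall>\<^sub>F w in at z. w \<in> S - {z}"
    using S(1,2) by (rule eventually_at_in_open)
  ultimately show ?thesis
    by (auto elim: eventually_mono)
qed

text \<open>
  Poles of the rotated function could only matter if they accumulated. Then the denominator would vanish
  identically near a point, so \<open>f\<close> would be constant there, against the lower bound on \<open>|f'|\<close>.
\<close>

lemma spherically_expanding_rotation:
  fixes f :: "complex \<Rightarrow> complex"
  assumes c: "c > 0" and f: "spherically_expanding c f" and unit: "(norm \<alpha>)\<^sup>2 + (norm \<beta>)\<^sup>2 = 1"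
  shows "spherically_expanding c (\<lambda>w. (\<alpha> * f w + \<beta>) / (cnj \<alpha> - cnj \<beta> * f w))"
proof -
  define d where "d = (\<lambda>w. cnj \<alpha> - cnj \<beta> * f w)"
  define g where "g = (\<lambda>w. (\<alpha> * f w + \<beta>) / d w)"
  have mero: "f meromorphic_on ball 0 1"
    using f by (simp add: spherically_expanding_def)
  have "\<forall>\<^sub>F w in at z. c * (1 + (norm (g w))\<^sup>2) \<le> norm (deriv g w)" if z: "z \<in> ball 0 1" for z
  proof -
    have mero_z: "f meromorphic_on {z}"
      using mero z meromorphic_on_subset by blast
    have exp: "\<forall>\<^sub>F w in at z. c * (1 + (norm (f w))\<^sup>2) \<le> norm (deriv f w)"
      using f z unfolding spherically_expanding_def by blast
    have "\<forall>\<^sub>F w in at z. d w \<noteq> 0"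
    proof (rule non_zero_neighbour)
      have "d meromorphic_on {z}"
        unfolding d_def by (intro meromorphic_intros mero_z)
      then show "isolated_singularity_at d z" "not_essential d z"
        by (rule meromorphic_on_isolated_singularity meromorphic_on_not_essential)+
      show "\<exists>\<^sub>F w in at z. d w \<noteq> 0"
      proof (rule ccontr)
        assume "\<not> ?thesis"
        then have d0: "\<forall>\<^sub>F w in at z. d w = 0"
          by (simp add: frequently_def)
        have "\<forall>\<^sub>F w in at z. f w = cnj \<alpha> / cnj \<beta>"
          using d0
        proof eventually_elim
          case (elim w)
          then show ?case
            using unit by (cases "\<beta> = 0") (auto simp: d_def field_simps)
        qed
        then have "\<forall>\<^sub>F w in at z. deriv f w = 0"
          by (rule eventually_const_imp_deriv_0)
        with exp have "\<forall>\<^sub>F w in at z. False"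
        proof eventually_elim
          case (elim w)
          have "0 < c * (1 + (norm (f w))\<^sup>2)"
            using c by (simp add: add_pos_nonneg)
          with elim show ?case by simp
        qed
        then show False by simp
      qed
    qed
    moreover have "\<forall>\<^sub>F w in at z. f analytic_on {w}"
      using mero_z meromorphic_on_isolated_singularity isolated_singularity_at_altdef by blast
    ultimately show ?thesis
      using exp
    proof eventually_elim
      case (elim w)
      have "(f has_field_derivative deriv f w) (at w)"
        using elim(2) analytic_on_imp_differentiable_at DERIV_deriv_iff_field_differentiable by blast
      note rot = sphere_rotation_density[OF this unit elim(1)[unfolded d_def]]
      have "norm (deriv g w) = norm (deriv f w) / (norm (d w))\<^sup>2"
        using DERIV_imp_deriv[OF rot(1)] by (simp add: g_def d_def norm_divide norm_power)
      moreover have "1 + (norm (g w))\<^sup>2 = (1 + (norm (f w))\<^sup>2) / (norm (d w))\<^sup>2"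
        using rot(2) by (simp add: g_def d_def)
      ultimately show ?case
        using elim(3) divide_right_mono[of _ _ "(norm (d w))\<^sup>2"] by simp
    qed
  qed
  moreover have "g meromorphic_on ball 0 1"
    unfolding g_def d_def by (intro meromorphic_intros mero)
  ultimately show ?thesis
    unfolding spherically_expanding_def g_def d_def by blast
qed

section \<open>The classes of functions in the disc\<close>

lemma F_class_spherically_expanding:
  assumes "f \<in> F_class c"
  shows "spherically_expanding c f"
  unfolding spherically_expanding_def
proof (intro conjI ballI)
  show mero: "f meromorphic_on ball 0 1"
    using assms by (simp add: F_class_def nicely_meromorphic_on_def)
  fix z :: complex assume z: "z \<in> ball 0 1"
  have "f meromorphic_on {z}"
    using mero z meromorphic_on_subset by blast
  then have "\<forall>\<^sub>F w in at z. f analytic_on {w}"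
    using meromorphic_on_isolated_singularity isolated_singularity_at_altdef by blast
  moreover have "\<forall>\<^sub>F w in at z. w \<in> ball 0 1"
    using z by (intro eventually_at_in_open') auto
  ultimately show "\<forall>\<^sub>F w in at z. c * (1 + (norm (f w))\<^sup>2) \<le> norm (deriv f w)"
  proof eventually_elim
    case (elim w)
    have "c \<le> spherical_deriv f w"
      using assms elim(2) by (simp add: F_class_def)
    also have "\<dots> = norm (deriv f w) / (1 + (norm (f w))\<^sup>2)"
      using analytic_at_imp_no_pole[OF elim(1)] by (simp add: spherical_deriv_def)
    finally show ?case
      by (simp add: pos_le_divide_eq add_pos_nonneg)
  qed
qed

text \<open>
  A rotation takes the value of \<open>f\<close> at \<open>a\<close> to \<open>0\<close> and leaves \<open>f\<^sup>\<sharp>\<close> unchanged. At a pole the rotation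
  is \<open>p \<mapsto> 1 / p\<close>; otherwise it is \<open>p \<mapsto> (p - f a) / (1 + cnj (f a) p)\<close>, normalised by the factor
  \<open>n\<close>.
\<close>

lemma F_class_quadratic_bound:
  assumes c: "c > 0" and f: "f \<in> F_class c" and a: "a \<in> ball 0 1"
  defines "s \<equiv> spherical_deriv f a" and "\<delta> \<equiv> 1 - (norm a)\<^sup>2"
  shows "c * (1 + \<delta>\<^sup>2 * s\<^sup>2) \<le> s" "c * (1 + \<delta>\<^sup>2 * s\<^sup>2) = s \<Longrightarrow> a = 0"
proof -
  have nice: "f nicely_meromorphic_on ball 0 1"
    using f by (simp add: F_class_def)
  note exp = F_class_spherically_expanding[OF f]
  obtain g where g: "spherically_expanding c g" "g analytic_on {a}" "g a = 0" "norm (deriv g a) = s"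
  proof (cases "is_pole f a")
    case True
    define g where "g = (\<lambda>w. inverse (f w))"
    \<comment> \<open>The choice \<open>\<alpha> = 0\<close>, \<open>\<beta> = \<i>\<close> gives exactly the reciprocal; \<open>\<beta> = 1\<close> would give its negative.\<close>
    have "spherically_expanding c (\<lambda>w. (0 * f w + \<i>) / (cnj 0 - cnj \<i> * f w))"
      using c exp by (rule spherically_expanding_rotation) simp
    then have g_exp: "spherically_expanding c g"
      by (simp add: g_def divide_inverse mult.assoc[symmetric])
    \<comment> \<open>At a pole the value of \<open>f\<close> is the default \<open>0\<close>, so \<open>g\<close> takes the right value
      \<open>inverse 0 = 0\<close> there.\<close>
    have "is_pole f a \<and> f a = 0 \<or> f \<midarrow>a\<rightarrow> f a"
      using nice a unfolding nicely_meromorphic_on_def by blast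
    then have fa: "f a = 0"
      using True not_tendsto_and_filterlim_at_infinity[of "at a" f] by (auto simp: is_pole_def)
    have g_ana: "g analytic_on {a}"
    proof (rule meromorphic_at_isCont_imp_analytic)
      show "g meromorphic_on {a}"
        using g_exp a meromorphic_on_subset unfolding spherically_expanding_def by blast
      have "g \<midarrow>a\<rightarrow> 0"
        using True unfolding is_pole_def g_def by (rule tendsto_inverse_0[THEN filterlim_compose])
      then show "isCont g a"
        using fa by (simp add: isCont_def g_def)
    qed
    have "s = spherical_deriv g a"
      unfolding s_def g_def by (rule spherical_deriv_pole(2)[OF nice a True])
    also have "\<dots> = norm (deriv g a)"
      using analytic_at_imp_no_pole[OF g_ana] fa by (simp add: spherical_deriv_def g_def)
    finally show thesis
      using that[of g] g_exp g_ana fa by (simp add: g_def)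
  next
    case False
    have ana: "f analytic_on {a}"
      using nice a False by (rule nicely_meromorphic_on_imp_analytic_at)
    define n where "n = sqrt (1 + (norm (f a))\<^sup>2)"
    have n2: "n\<^sup>2 = 1 + (norm (f a))\<^sup>2" and n: "n > 0"
      by (auto simp: n_def add_pos_nonneg)
    define \<alpha> \<beta> where "\<alpha> = complex_of_real (1 / n)" and "\<beta> = - f a / of_real n"
    define g where "g = (\<lambda>w. (\<alpha> * f w + \<beta>) / (cnj \<alpha> - cnj \<beta> * f w))"
    have unit: "(norm \<alpha>)\<^sup>2 + (norm \<beta>)\<^sup>2 = 1"
    proof -
      have "(norm \<alpha>)\<^sup>2 + (norm \<beta>)\<^sup>2 = (1 + (norm (f a))\<^sup>2) / n\<^sup>2"
        by (simp add: \<alpha>_def \<beta>_def norm_divide power_divide add_divide_distrib)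
      with n n2[symmetric] show ?thesis by simp
    qed
    have den: "cnj \<alpha> - cnj \<beta> * f a = of_real n"
    proof -
      have "cnj \<alpha> - cnj \<beta> * f a = of_real (1 + (norm (f a))\<^sup>2) / of_real n"
        unfolding of_real_add complex_norm_square by (simp add: \<alpha>_def \<beta>_def add_divide_distrib mult.commute)
      also have "\<dots> = of_real n"
        using n unfolding n2[symmetric] by (simp add: power2_eq_square)
      finally show ?thesis .
    qed
    have df: "(f has_field_derivative deriv f a) (at a)"
      using ana analytic_on_imp_differentiable_at DERIV_deriv_iff_field_differentiable by blast
    have "deriv g a = deriv f a / (of_real n)\<^sup>2"
      using DERIV_imp_deriv[OF sphere_rotation_density(1)[OF df unit]] den n by (simp add: g_def)
    then have "norm (deriv g a) = s"
      using n n2 False by (simp add: s_def spherical_deriv_def norm_divide norm_power)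
    moreover have "g analytic_on {a}"
      unfolding g_def using den n by (intro analytic_intros ana) auto
    moreover have "g a = 0"
      by (simp add: g_def \<alpha>_def \<beta>_def)
    moreover have "spherically_expanding c g"
      unfolding g_def using c exp unit by (rule spherically_expanding_rotation)
    ultimately show thesis
      using that by blast
  qed
  show "c * (1 + \<delta>\<^sup>2 * s\<^sup>2) \<le> s" "c * (1 + \<delta>\<^sup>2 * s\<^sup>2) = s \<Longrightarrow> a = 0"
    using spherically_expanding_bound_at_zero[OF c g(1) a g(2,3)] unfolding g(4) \<delta>_def by blast+
qed

section \<open>The quadratic inequality and the extremal functions\<close>

lemma quadratic_inequality_roots:
  fixes c d s :: real
  assumes c: "c > 0" and d: "d > 0" and s: "c * (1 + d\<^sup>2 * s\<^sup>2) \<le> s"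
  shows "4 * c\<^sup>2 * d\<^sup>2 \<le> 1"
    and "(1 - sqrt (1 - 4 * c\<^sup>2 * d\<^sup>2)) / (2 * c * d\<^sup>2) \<le> s"
    and "s \<le> (1 + sqrt (1 - 4 * c\<^sup>2 * d\<^sup>2)) / (2 * c * d\<^sup>2)"
proof -
  have "(2 * c * d\<^sup>2 * s - 1)\<^sup>2 - (1 - 4 * c\<^sup>2 * d\<^sup>2) = 4 * c * d\<^sup>2 * (c * (1 + d\<^sup>2 * s\<^sup>2) - s)"
    by (simp add: algebra_simps power2_eq_square)
  also have "\<dots> \<le> 0"
    using c d s by (intro mult_nonneg_nonpos) auto
  finally have sq: "(2 * c * d\<^sup>2 * s - 1)\<^sup>2 \<le> 1 - 4 * c\<^sup>2 * d\<^sup>2"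
    by simp
  then show "4 * c\<^sup>2 * d\<^sup>2 \<le> 1"
    by (smt (verit) zero_le_power2)
  have "\<bar>2 * c * d\<^sup>2 * s - 1\<bar> \<le> sqrt (1 - 4 * c\<^sup>2 * d\<^sup>2)"
    using sq by (rule real_le_rsqrt[of "\<bar>_\<bar>", unfolded power2_abs])
  then have "1 - sqrt (1 - 4 * c\<^sup>2 * d\<^sup>2) \<le> s * (2 * c * d\<^sup>2)"
      "s * (2 * c * d\<^sup>2) \<le> 1 + sqrt (1 - 4 * c\<^sup>2 * d\<^sup>2)"
    by (simp_all add: abs_le_iff mult.commute mult.left_commute)
  then show "(1 - sqrt (1 - 4 * c\<^sup>2 * d\<^sup>2)) / (2 * c * d\<^sup>2) \<le> s"
      "s \<le> (1 + sqrt (1 - 4 * c\<^sup>2 * d\<^sup>2)) / (2 * c * d\<^sup>2)"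
    using c d by (simp_all add: pos_le_divide_eq pos_divide_le_eq)
qed

lemma quadratic_roots:
  fixes c d s :: real
  assumes c: "c > 0" and d: "d > 0" and disc: "4 * c\<^sup>2 * d\<^sup>2 \<le> 1"
    and s: "s = (1 - sqrt (1 - 4 * c\<^sup>2 * d\<^sup>2)) / (2 * c * d\<^sup>2) \<or>
            s = (1 + sqrt (1 - 4 * c\<^sup>2 * d\<^sup>2)) / (2 * c * d\<^sup>2)"
  shows "c * (1 + d\<^sup>2 * s\<^sup>2) = s"
proof -
  have "s * (2 * c * d\<^sup>2) - 1 = - sqrt (1 - 4 * c\<^sup>2 * d\<^sup>2) \<or>
        s * (2 * c * d\<^sup>2) - 1 = sqrt (1 - 4 * c\<^sup>2 * d\<^sup>2)"
    using s c d by auto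
  then have "(s * (2 * c * d\<^sup>2) - 1)\<^sup>2 = 1 - 4 * c\<^sup>2 * d\<^sup>2"
    using disc by auto
  then have "4 * c * d\<^sup>2 * (c * (1 + d\<^sup>2 * s\<^sup>2) - s) = 0"
    by (simp add: algebra_simps power2_eq_square)
  then show ?thesis
    using c d by simp
qed

text \<open>
  The spherical derivative of \<open>z \<mapsto> s z\<close> decreases radially from \<open>s\<close> to \<open>s / (1 + s\<^sup>2) = c\<close> at the unit
  circle.
\<close>

lemma linear_in_F_class:
  assumes c: "c > 0" and s: "c * (1 + s\<^sup>2) = s"
  shows "\<exists>f\<in>F_class c. spherical_deriv f 0 = s"
proof
  define f where "f = (\<lambda>z. complex_of_real s * z)"
  have ana: "f analytic_on A" for A
    unfolding f_def by (intro analytic_intros)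
  have "0 < c * (1 + s\<^sup>2)"
    using c by (simp add: add_pos_nonneg)
  with s have s0: "s > 0" by simp
  have sd: "spherical_deriv f z = s / (1 + s\<^sup>2 * (norm z)\<^sup>2)" for z
  proof -
    have "(f has_field_derivative of_real s) (at z)"
      unfolding f_def by (auto intro!: derivative_eq_intros)
    then have "deriv f z = of_real s"
      by (rule DERIV_imp_deriv)
    then show ?thesis
      using analytic_at_imp_no_pole[OF ana] s0
      by (simp add: spherical_deriv_def f_def norm_mult power_mult_distrib)
  qed
  show "spherical_deriv f 0 = s"
    by (simp add: sd)
  have "c \<le> spherical_deriv f z" if z: "z \<in> ball 0 1" for z
  proof -
    have "(norm z)\<^sup>2 \<le> 1"
      using z by (simp add: power_le_one)
    then have "c * (1 + s\<^sup>2 * (norm z)\<^sup>2) \<le> c * (1 + s\<^sup>2 * 1)"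
      using c by (intro mult_left_mono add_left_mono) auto
    then show ?thesis
      using s by (simp add: sd pos_le_divide_eq add_pos_nonneg)
  qed
  then show "f \<in> F_class c"
    using analytic_on_imp_nicely_meromorphic_on[OF ana] by (simp add: F_class_def)
qed

theorem theorem1p2:
  fixes c :: real
  assumes "c > 0"
  shows "(\<forall>f\<in>F_class c. \<forall>z0\<in>ball 0 1.
            (1 - sqrt (1 - 4 * c\<^sup>2 * (1 - (norm z0)\<^sup>2)\<^sup>2)) / (2 * c * (1 - (norm z0)\<^sup>2)\<^sup>2)
              \<le> spherical_deriv f z0 \<and>
            spherical_deriv f z0
              \<le> (1 + sqrt (1 - 4 * c\<^sup>2 * (1 - (norm z0)\<^sup>2)\<^sup>2)) / (2 * c * (1 - (norm z0)\<^sup>2)\<^sup>2)) \<and>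
         (F_class c \<noteq> {} \<longrightarrow>
           (\<forall>z0\<in>ball 0 1.
             ((\<exists>f\<in>F_class c. spherical_deriv f z0 =
                (1 - sqrt (1 - 4 * c\<^sup>2 * (1 - (norm z0)\<^sup>2)\<^sup>2)) / (2 * c * (1 - (norm z0)\<^sup>2)\<^sup>2))
              \<longleftrightarrow> z0 = 0) \<and>
             ((\<exists>f\<in>F_class c. spherical_deriv f z0 =
                (1 + sqrt (1 - 4 * c\<^sup>2 * (1 - (norm z0)\<^sup>2)\<^sup>2)) / (2 * c * (1 - (norm z0)\<^sup>2)\<^sup>2))
              \<longleftrightarrow> z0 = 0)))"
proof -
  define lo where "lo = (\<lambda>z0::complex. (1 - sqrt (1 - 4 * c\<^sup>2 * (1 - (norm z0)\<^sup>2)\<^sup>2)) / (2 * c * (1 - (norm z0)\<^sup>2)\<^sup>2))"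
  define up where "up = (\<lambda>z0::complex. (1 + sqrt (1 - 4 * c\<^sup>2 * (1 - (norm z0)\<^sup>2)\<^sup>2)) / (2 * c * (1 - (norm z0)\<^sup>2)\<^sup>2))"
  have pos: "0 < 1 - (norm z)\<^sup>2" if "z \<in> ball 0 1" for z :: complex
    using that by (simp add: abs_square_less_1)
  have bounds: "lo z \<le> spherical_deriv f z" "spherical_deriv f z \<le> up z"
      "4 * c\<^sup>2 * (1 - (norm z)\<^sup>2)\<^sup>2 \<le> 1"
    if "f \<in> F_class c" "z \<in> ball 0 1" for f z
    using quadratic_inequality_roots[OF assms pos F_class_quadratic_bound(1)[OF assms that]] that(2)
    by (simp_all add: lo_def up_def)
  have sharp: "(\<exists>f\<in>F_class c. spherical_deriv f z = r) \<longleftrightarrow> z = 0"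
    if ne: "F_class c \<noteq> {}" and z: "z \<in> ball 0 1" and r: "r = lo z \<or> r = up z" for z r
  proof -
    \<comment> \<open>A nonempty class makes the discriminant nonnegative; otherwise \<open>sqrt\<close> of a negative number
      would not yield roots.\<close>
    have disc: "4 * c\<^sup>2 * (1 - (norm z)\<^sup>2)\<^sup>2 \<le> 1"
      using ne bounds(3) z by blast
    have root: "c * (1 + (1 - (norm z)\<^sup>2)\<^sup>2 * r\<^sup>2) = r"
      using quadratic_roots[OF assms pos[OF z] disc] r by (simp add: lo_def up_def)
    show ?thesis
    proof
      assume "\<exists>f\<in>F_class c. spherical_deriv f z = r"
      then show "z = 0"
        using F_class_quadratic_bound(2)[OF assms _ z] root by blast
    next
      assume "z = 0"
      then show "\<exists>f\<in>F_class c. spherical_deriv f z = r"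
        using linear_in_F_class[OF assms, of r] root by simp
    qed
  qed
  show ?thesis
    using bounds(1,2) sharp unfolding lo_def up_def by (intro conjI ballI impI) simp_all
qed

end
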